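(* Let $K$ be a field of characteristic $0$, and let $\mathfrak n_{2,3}$ be the free $3$-step nilpotent Lie algebra over $K$ in two generators, equipped with the ad-invariant metric $B_{2,3}$. Then the group of orthogonal automorphisms of $(\mathfrak n_{2,3},B_{2,3})$ is $$\operatorname{Auto}(\mathfrak n_{2,3})\simeq \mathcal S\ltimes H_1,$$ where $\mathcal S$ is the subgroup of $\mathcal G$ consisting of the matrices $\tilde A$ with $A\in\operatorname{GL}(2,K)$ and $\det(A)=\pm1$, $H_1$ is the Heisenberg Lie group of dimension three over $K$, and the action in the semidirect product is the restriction to $\mathcal S$ of the action of $\mathcal G$ on $H_1$ given in the context.
   Context: $\mathfrak n_{2,3}$ is the $5$-dimensional Lie algebra over $K$ with basis $e_1,\dots,e_5$ and nonzero brackets $[e_1,e_2]=e_3$, $[e_1,e_3]=e_4$, $[e_2,e_3]=e_5$ (up to antisymmetry). Linear maps of $\mathfrak n_{2,3}$ are identified with their $5\times5$ matrices in this basis (the $j$-th column is the image of $e_j$). $B_{2,3}=\langle\,,\,\rangle$ is the symmetric bilinear form on $\mathfrak n_{2,3}$ with $\langle e_1,e_5\rangle=1$, $\langle e_2,e_4\rangle=-1$, $\langle e_3,e_3\rangle=1$, and $\langle e_i,e_j\rangle=0$ for all other pairs $i\le j$. It is ad-invariant: $\langle [x,y],z\rangle+\langle y,[x,z]\rangle=0$ for all $x,y,z$. $\operatorname{Auto}(\mathfrak n_{2,3})$ is the group of Lie algebra automorphisms $\alpha$ of $\mathfrak n_{2,3}$ with $\langle\alpha x,\alpha y\rangle=\langle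 x,y\rangle$ for all $x,y$. $\mathcal G=\{\tilde A:A\in\operatorname{GL}(2,K)\}\subset\operatorname{Aut}(\mathfrak n_{2,3})$, where $\tilde A$ is the block diagonal matrix with diagonal blocks $A$, $\det(A)$, $\det(A)A$ (of sizes $2,1,2$). $H_1$ is the group with underlying set $K^3$ and product $(x,y,z)(x',y',z')=(x+x',\,y+y',\,z+z'+\tfrac12(xy'-x'y))$. It is isomorphic, via $(x,y,z)\mapsto h_{(x,y,z)}$, to the subgroup $\mathcal H=\{h_{(x,y,z)}\}$ of $\operatorname{Aut}(\mathfrak n_{2,3})$, where $$h_{(x,y,z)}=\begin{pmatrix} 1&0&0&0&0 \\ 0&1&0&0&0 \\ y&x&1&0&0 \\ z+\frac12xy&\frac12x^2&x&1&0 \\ -\frac12y^2&z-\frac12xy&-y&0&1 \end{pmatrix}.$$ Conjugation by elements of $\mathcal G$ preserves $\mathcal H$; the action of $\mathcal G$ on $H_1$ is the one obtained from $h\mapsto\tilde A h\tilde A^{-1}$ through the isomorphism $H_1\simeq\mathcal H$. *)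

theory Defs
  imports "HOL-Analysis.Analysis" "HOL-Algebra.Bij"
begin

section \<open>Coordinates in dimension five\<close>

text \<open>In the index type \<^typ>\<open>5\<close> the element \<open>5\<close> coincides with \<open>0\<close>; its five
  elements are written \<open>1, \<dots>, 5\<close>, so that \<open>x $ i\<close> is the coordinate of \<open>x\<close> along \<open>e\<^sub>i\<close>.\<close>

lemma exhaust_5:
  fixes x :: 5
  shows "x = 1 \<or> x = 2 \<or> x = 3 \<or> x = 4 \<or> x = 5"
proof (induct x)
  case (of_int z)
  then have "0 \<le> z" and "z < 5" by simp_all
  then have "z = 0 \<or> z = 1 \<or> z = 2 \<or> z = 3 \<or> z = 4" by arith
  then show ?case by auto
qed

lemma forall_5: "(\<forall>i::5. P i) \<longleftrightarrow> P 1 \<and> P 2 \<and> P 3 \<and> P 4 \<and> P 5"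
  by (metis exhaust_5)

lemma UNIV_5: "UNIV = {1, 2, 3, 4, 5::5}"
  using exhaust_5 by auto

lemma sum_5: "sum f (UNIV::5 set) = f 1 + f 2 + f 3 + f 4 + f 5"
  unfolding UNIV_5 by (simp add: ac_simps)

lemma vector_5 [simp]:
  "(vector [a,b,c,d,e] :: ('a::zero)^5) $ 1 = a"
  "(vector [a,b,c,d,e] :: ('a::zero)^5) $ 2 = b"
  "(vector [a,b,c,d,e] :: ('a::zero)^5) $ 3 = c"
  "(vector [a,b,c,d,e] :: ('a::zero)^5) $ 4 = d"
  "(vector [a,b,c,d,e] :: ('a::zero)^5) $ 5 = e"
  unfolding vector_def by simp_all

section \<open>The metric Lie algebra\<close>

text \<open>The free 3-step nilpotent Lie algebra on two generators, in the basis
  \<open>e\<^sub>1, e\<^sub>2, e\<^sub>3 = [e\<^sub>1, e\<^sub>2], e\<^sub>4 = [e\<^sub>1, e\<^sub>3], e\<^sub>5 = [e\<^sub>2, e\<^sub>3]\<close>; the other brackets of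
  basis vectors vanish up to antisymmetry.\<close>

definition bracket :: "'a::field_char_0 ^ 5 \<Rightarrow> 'a ^ 5 \<Rightarrow> 'a ^ 5" where
  "bracket x y = vector
     [0,
      0,
      x $ 1 * y $ 2 - x $ 2 * y $ 1,
      x $ 1 * y $ 3 - x $ 3 * y $ 1,
      x $ 2 * y $ 3 - x $ 3 * y $ 2]"

definition bform :: "'a::field_char_0 ^ 5 \<Rightarrow> 'a ^ 5 \<Rightarrow> 'a" where
  "bform x y = x $ 1 * y $ 5 + x $ 5 * y $ 1 - x $ 2 * y $ 4 - x $ 4 * y $ 2 + x $ 3 * y $ 3"

lemma bracket_basis:
  "bracket (axis 1 1) (axis 2 1) = (axis 3 1 :: 'a::field_char_0 ^ 5)"
  "bracket (axis 1 1) (axis 3 1) = (axis 4 1 :: 'a ^ 5)"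
  "bracket (axis 2 1) (axis 3 1) = (axis 5 1 :: 'a ^ 5)"
  "i \<in> {4, 5} \<Longrightarrow> bracket (axis i 1) (axis j 1) = (0 :: 'a ^ 5)"
  by (auto simp: bracket_def vec_eq_iff forall_5 axis_def)

lemma bracket_bilinear:
  "bracket (x + y) z = bracket x z + bracket y z"
  "bracket x (y + z) = bracket x y + bracket x z"
  "bracket (c *s x) y = c *s bracket x y"
  "bracket x (c *s y) = c *s bracket x y"
  by (simp_all add: bracket_def vec_eq_iff forall_5 algebra_simps)

lemma bracket_self: "bracket x x = 0"
  by (simp add: bracket_def vec_eq_iff forall_5)

lemma bracket_jacobi:
  "bracket x (bracket y z) + bracket y (bracket z x) + bracket z (bracket x y) = 0"
  by (simp add: bracket_def vec_eq_iff forall_5 algebra_simps)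

lemma bform_basis:
  "bform (axis 1 1) (axis 5 1) = (1 :: 'a::field_char_0)"
  "bform (axis 2 1) (axis 4 1) = (-1 :: 'a)"
  "bform (axis 3 1) (axis 3 1) = (1 :: 'a)"
  by (simp_all add: bform_def axis_def)

lemma bform_sym: "bform x y = bform y x"
  by (simp add: bform_def algebra_simps)

lemma bform_ad_invariant: "bform (bracket x y) z + bform y (bracket x z) = 0"
  by (simp add: bracket_def bform_def algebra_simps)

section \<open>Automorphism groups\<close>

definition lie_auts :: "('a::field_char_0 ^ 5 \<Rightarrow> 'a ^ 5) set" where
  "lie_auts = {f. Vector_Spaces.linear (*s) (*s) f \<and> bij f \<and>
                  (\<forall>x y. f (bracket x y) = bracket (f x) (f y))}"

definition orth_auts :: "('a::field_char_0 ^ 5 \<Rightarrow> 'a ^ 5) set" where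
  "orth_auts = {f \<in> lie_auts. \<forall>x y. bform (f x) (f y) = bform x y}"

definition Auto_group :: "('a::field_char_0 ^ 5 \<Rightarrow> 'a ^ 5) monoid" where
  "Auto_group = \<lparr>carrier = orth_auts, mult = (\<circ>), one = id\<rparr>"

text \<open>Matrices act on column vectors by \<open>(*v)\<close>, so the \<open>j\<close>-th column of \<open>M\<close> is the image of
  \<open>e\<^sub>j\<close>; the matrices below are written row by row.\<close>

section \<open>The groups of block diagonal matrices\<close>

definition tilde :: "'a::field_char_0 ^ 2 ^ 2 \<Rightarrow> 'a ^ 5 ^ 5" where
  "tilde A = vector
     [vector [A $ 1 $ 1, A $ 1 $ 2, 0, 0, 0],
      vector [A $ 2 $ 1, A $ 2 $ 2, 0, 0, 0],
      vector [0, 0, det A, 0, 0],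
      vector [0, 0, 0, det A * A $ 1 $ 1, det A * A $ 1 $ 2],
      vector [0, 0, 0, det A * A $ 2 $ 1, det A * A $ 2 $ 2]]"

definition G_group :: "('a::field_char_0 ^ 5 ^ 5) monoid" where
  "G_group = \<lparr>carrier = {tilde A | A. invertible A}, mult = (**), one = mat 1\<rparr>"

definition S_group :: "('a::field_char_0 ^ 5 ^ 5) monoid" where
  "S_group = G_group \<lparr>carrier := {tilde A | A. invertible A \<and> (det A = 1 \<or> det A = -1)}\<rparr>"

section \<open>The Heisenberg group and the action on it\<close>

definition heis_group :: "('a::field_char_0 \<times> 'a \<times> 'a) monoid" where
  "heis_group = \<lparr>carrier = UNIV,
     mult = (\<lambda>(x, y, z) (x', y', z'). (x + x', y + y', z + z' + (x * y' - x' * y) / 2)),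
     one = (0, 0, 0)\<rparr>"

definition heis_mat :: "'a::field_char_0 \<times> 'a \<times> 'a \<Rightarrow> 'a ^ 5 ^ 5" where
  "heis_mat = (\<lambda>(x, y, z). vector
     [vector [1, 0, 0, 0, 0],
      vector [0, 1, 0, 0, 0],
      vector [y, x, 1, 0, 0],
      vector [z + x * y / 2, x\<^sup>2 / 2, x, 1, 0],
      vector [- (y\<^sup>2 / 2), z - x * y / 2, - y, 0, 1]])"

text \<open>Conjugation by \<open>g\<close>, transported along the isomorphism \<^const>\<open>heis_mat\<close> onto its image.
  For \<open>g\<close> in \<open>G_group\<close> the conjugate is in that image, see \<open>heis_mat_action\<close> below.\<close>

definition heis_action ::
    "'a::field_char_0 ^ 5 ^ 5 \<Rightarrow> 'a \<times> 'a \<times> 'a \<Rightarrow> 'a \<times> 'a \<times> 'a" where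
  "heis_action g p = (THE q. heis_mat q = g ** heis_mat p ** matrix_inv g)"

section \<open>Semidirect products\<close>

text \<open>\<open>semidirect S H \<phi>\<close> is \<open>S \<ltimes> H\<close> for \<open>\<phi> \<in> hom S (AutoGroup H)\<close>; the pair \<open>(s, h)\<close>
  stands for the product \<open>h s\<close>, and \<open>s h s\<^sup>-\<^sup>1 = \<phi> s h\<close>.\<close>

definition semidirect ::
    "('s, 'm) monoid_scheme \<Rightarrow> ('h, 'n) monoid_scheme \<Rightarrow> ('s \<Rightarrow> 'h \<Rightarrow> 'h) \<Rightarrow> ('s \<times> 'h) monoid" where
  "semidirect S H \<phi> = \<lparr>carrier = carrier S \<times> carrier H,
     mult = (\<lambda>(s, h) (s', h'). (s \<otimes>\<^bsub>S\<^esub> s', h \<otimes>\<^bsub>H\<^esub> \<phi> s h')),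
     one = (\<one>\<^bsub>S\<^esub>, \<one>\<^bsub>H\<^esub>)\<rparr>"

section \<open>Well-definedness\<close>

lemma mat5_eq_iff: "(M = N) \<longleftrightarrow> (\<forall>i j. M $ i $ j = N $ i $ j)" for M N :: "'a ^ 5 ^ 5"
  by (simp add: vec_eq_iff)

lemma mult5: "(M ** N) $ i $ j = M $ i $ 1 * N $ 1 $ j + M $ i $ 2 * N $ 2 $ j + M $ i $ 3 * N $ 3 $ j +
    M $ i $ 4 * N $ 4 $ j + M $ i $ 5 * N $ 5 $ j" for M N :: "'a::semiring_1 ^ 5 ^ 5"
  by (simp add: matrix_matrix_mult_def sum_5)

lemma mult2: "(M ** N) $ i $ j = M $ i $ 1 * N $ 1 $ j + M $ i $ 2 * N $ 2 $ j"
  for M N :: "'a::semiring_1 ^ 2 ^ 2"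
  by (simp add: matrix_matrix_mult_def sum_2)

lemma mat_nth: "(mat c :: 'a::zero ^ 'n ^ 'n) $ i $ j = (if i = j then c else 0)"
  by (simp add: mat_def)

lemmas mat5_simps = mat5_eq_iff forall_5 mult5 mat_nth

lemma tilde_mult: "tilde (A ** B) = tilde A ** tilde B"
  by (simp add: mat5_simps mult2 tilde_def det_mul algebra_simps)

lemma tilde_one: "tilde (mat 1) = mat 1"
  by (simp add: mat5_simps tilde_def)

lemma invertible_mat_1: "invertible (mat 1 :: 'a::semiring_1 ^ 'n ^ 'n)"
  unfolding invertible_def by (rule exI[of _ "mat 1"]) simp

lemma invertible_obtain:
  assumes "invertible A"
  obtains B where "A ** B = mat 1" "B ** A = mat 1" "invertible B"
  using assms unfolding invertible_def by blast

lemma tilde_in_G: "invertible A \<Longrightarrow> tilde A \<in> carrier G_group"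
  by (auto simp: G_group_def)

lemma G_group_obtain:
  assumes "g \<in> carrier G_group"
  obtains A where "g = tilde A" "invertible A"
  using assms by (auto simp: G_group_def)

lemma group_G: "group (G_group :: ('a::field_char_0 ^ 5 ^ 5) monoid)"
proof (rule groupI)
  fix x y z :: "'a ^ 5 ^ 5"
  assume x: "x \<in> carrier G_group" and y: "y \<in> carrier G_group"
  obtain A where A: "x = tilde A" "invertible A" using x by (rule G_group_obtain)
  obtain C where C: "y = tilde C" "invertible C" using y by (rule G_group_obtain)
  have "x \<otimes>\<^bsub>G_group\<^esub> y = tilde (A ** C)"
    by (simp add: G_group_def tilde_mult A C)
  then show "x \<otimes>\<^bsub>G_group\<^esub> y \<in> carrier G_group"
    using tilde_in_G[OF invertible_mult[OF A(2) C(2)]] by simp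
  show "x \<otimes>\<^bsub>G_group\<^esub> y \<otimes>\<^bsub>G_group\<^esub> z = x \<otimes>\<^bsub>G_group\<^esub> (y \<otimes>\<^bsub>G_group\<^esub> z)"
    by (simp add: G_group_def matrix_mul_assoc)
  show "\<one>\<^bsub>G_group\<^esub> \<otimes>\<^bsub>G_group\<^esub> x = x"
    by (simp add: G_group_def)
  obtain B where B: "A ** B = mat 1" "B ** A = mat 1" "invertible B"
    using A(2) by (rule invertible_obtain)
  have "tilde B \<otimes>\<^bsub>G_group\<^esub> x = \<one>\<^bsub>G_group\<^esub>"
    by (simp add: G_group_def A B tilde_one flip: tilde_mult)
  then show "\<exists>y\<in>carrier G_group. y \<otimes>\<^bsub>G_group\<^esub> x = \<one>\<^bsub>G_group\<^esub>"
    using tilde_in_G[OF B(3)] by blast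
next
  show "\<one>\<^bsub>G_group\<^esub> \<in> carrier (G_group :: ('a ^ 5 ^ 5) monoid)"
    using tilde_in_G[OF invertible_mat_1] by (simp add: tilde_one) (simp add: G_group_def)
qed

lemma matrix_inv_eq:
  fixes M N :: "'a::semiring_1 ^ 'n ^ 'n"
  assumes "M ** N = mat 1" "N ** M = mat 1"
  shows "matrix_inv M = N"
proof -
  have "M ** matrix_inv M = mat 1 \<and> matrix_inv M ** M = mat 1"
    unfolding matrix_inv_def by (rule someI[of _ N]) (simp add: assms)
  then have "matrix_inv M = (N ** M) ** matrix_inv M" "N ** (M ** matrix_inv M) = N"
    by (simp_all add: assms)
  then show ?thesis by (simp add: matrix_mul_assoc)
qed

lemma tilde_inverse:
  assumes "A ** B = mat 1" "B ** A = mat 1"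
  shows "tilde A ** tilde B = mat 1" "tilde B ** tilde A = mat 1" "matrix_inv (tilde A) = tilde B"
proof -
  show "tilde A ** tilde B = mat 1" "tilde B ** tilde A = mat 1"
    by (simp_all add: assms tilde_one flip: tilde_mult)
  then show "matrix_inv (tilde A) = tilde B" by (rule matrix_inv_eq)
qed

lemma S_group_obtain:
  assumes "g \<in> carrier S_group"
  obtains A where "g = tilde A" "invertible A" "det A = 1 \<or> det A = -1"
  using assms by (auto simp: S_group_def)

lemma tilde_in_S: "invertible A \<Longrightarrow> det A = 1 \<or> det A = -1 \<Longrightarrow> tilde A \<in> carrier S_group"
  by (auto simp: S_group_def)

lemma subgroup_S: "subgroup (carrier S_group) (G_group :: ('a::field_char_0 ^ 5 ^ 5) monoid)"
proof (rule group.subgroupI[OF group_G])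
  show "carrier S_group \<subseteq> carrier (G_group :: ('a ^ 5 ^ 5) monoid)"
    by (auto simp: S_group_def G_group_def)
  have "tilde (mat 1) \<in> carrier (S_group :: ('a ^ 5 ^ 5) monoid)"
    by (rule tilde_in_S[OF invertible_mat_1]) simp
  then show "carrier (S_group :: ('a ^ 5 ^ 5) monoid) \<noteq> {}" by blast
next
  fix x :: "'a ^ 5 ^ 5"
  assume x: "x \<in> carrier S_group"
  obtain A where A: "x = tilde A" "invertible A" "det A = 1 \<or> det A = -1"
    using x by (rule S_group_obtain)
  obtain B where B: "A ** B = mat 1" "B ** A = mat 1" "invertible B"
    using A(2) by (rule invertible_obtain)
  have "det A * det B = 1" using arg_cong[OF B(1), of det] by (simp add: det_mul)
  then have "det B = 1 \<or> det B = -1" using A(3) by (auto simp: minus_equation_iff)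
  then have "tilde B \<in> carrier S_group" by (rule tilde_in_S[OF B(3)])
  moreover have "inv\<^bsub>G_group\<^esub> x = tilde B"
  proof (rule group.inv_equality[OF group_G])
    show "tilde B \<otimes>\<^bsub>G_group\<^esub> x = \<one>\<^bsub>G_group\<^esub>"
      by (simp add: G_group_def A tilde_inverse[OF B(1,2)])
  qed (simp_all add: A B tilde_in_G)
  ultimately show "inv\<^bsub>G_group\<^esub> x \<in> carrier S_group" by simp
  fix y :: "'a ^ 5 ^ 5"
  assume y: "y \<in> carrier S_group"
  obtain C where C: "y = tilde C" "invertible C" "det C = 1 \<or> det C = -1"
    using y by (rule S_group_obtain)
  have "x \<otimes>\<^bsub>G_group\<^esub> y = tilde (A ** C)" by (simp add: G_group_def A C tilde_mult)
  moreover have "det (A ** C) = 1 \<or> det (A ** C) = -1" using A(3) C(3) by (auto simp: det_mul)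
  ultimately show "x \<otimes>\<^bsub>G_group\<^esub> y \<in> carrier S_group"
    using tilde_in_S[OF invertible_mult[OF A(2) C(2)]] by simp
qed

lemma heis_mat_nth:
  "heis_mat (x, y, z) $ 1 = vector [1, 0, 0, 0, 0]"
  "heis_mat (x, y, z) $ 2 = vector [0, 1, 0, 0, 0]"
  "heis_mat (x, y, z) $ 3 = vector [y, x, 1, 0, 0]"
  "heis_mat (x, y, z) $ 4 = vector [z + x * y / 2, x\<^sup>2 / 2, x, 1, 0]"
  "heis_mat (x, y, z) $ 5 = vector [- (y\<^sup>2 / 2), z - x * y / 2, - y, 0, 1]"
  by (simp_all add: heis_mat_def)

lemma heis_mat_mult: "heis_mat (p \<otimes>\<^bsub>heis_group\<^esub> q) = heis_mat p ** heis_mat q"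
proof -
  obtain x y z where p: "p = (x, y, z)" by (cases p)
  obtain x' y' z' where q: "q = (x', y', z')" by (cases q)
  have "p \<otimes>\<^bsub>heis_group\<^esub> q = (x + x', y + y', z + z' + (x * y' - x' * y) / 2)"
    by (simp add: heis_group_def p q)
  then show ?thesis
    by (simp add: p q mat5_simps heis_mat_nth power2_eq_square)
      (simp add: algebra_simps add_divide_distrib diff_divide_distrib)
qed

lemma heis_mat_one: "heis_mat (0, 0, 0) = mat 1"
  by (simp add: mat5_simps heis_mat_nth)

lemma heis_mat_inj: "inj heis_mat"
proof (rule injI)
  fix p q :: "'a \<times> 'a \<times> 'a"
  assume eq: "heis_mat p = heis_mat q"
  obtain x y z where p: "p = (x, y, z)" by (cases p)
  obtain x' y' z' where q: "q = (x', y', z')" by (cases q)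
  have *: "heis_mat p $ i $ j = heis_mat q $ i $ j" for i j by (simp add: eq)
  show "p = q"
    using *[of 3 1] *[of 3 2] *[of 4 1] by (simp add: p q heis_mat_nth)
qed

lemma matvec5: "(M *v v) $ i = M $ i $ 1 * v $ 1 + M $ i $ 2 * v $ 2 + M $ i $ 3 * v $ 3 +
    M $ i $ 4 * v $ 4 + M $ i $ 5 * v $ 5" for M :: "'a::semiring_1 ^ 5 ^ 5"
  by (simp add: matrix_vector_mult_def sum_5)

lemma lie_autsI:
  assumes "invertible M"
    and "\<And>u v. M *v bracket u v = bracket (M *v u) (M *v v)"
  shows "(*v) M \<in> lie_auts"
  using assms unfolding lie_auts_def
  by (simp add: matrix_vector_mul_linear_gen invertible_eq_bij[symmetric])

lemma heis_mat_aut: "(*v) (heis_mat p) \<in> lie_auts"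
proof (rule lie_autsI)
  obtain x y z where p: "p = (x, y, z)" by (cases p)
  have "heis_mat p ** heis_mat (-x, -y, -z) = mat 1"
    "heis_mat (-x, -y, -z) ** heis_mat p = mat 1"
    by (simp_all add: p heis_group_def heis_mat_one flip: heis_mat_mult)
  then show "invertible (heis_mat p)" unfolding invertible_def by blast
  show "heis_mat p *v bracket u v = bracket (heis_mat p *v u) (heis_mat p *v v)" for u v
    by (simp add: vec_eq_iff forall_5 matvec5 p heis_mat_nth bracket_def)
      (simp add: algebra_simps add_divide_distrib diff_divide_distrib power2_eq_square)
qed

lemma tilde_aut:
  assumes "invertible A"
  shows "(*v) (tilde A) \<in> lie_auts"
proof (rule lie_autsI)
  obtain B where B: "A ** B = mat 1" "B ** A = mat 1" using assms by (rule invertible_obtain)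
  show "invertible (tilde A)" using tilde_inverse[OF B] unfolding invertible_def by blast
  show "tilde A *v bracket u v = bracket (tilde A *v u) (tilde A *v v)" for u v
    by (simp add: vec_eq_iff forall_5 matvec5 tilde_def bracket_def)
      (simp add: det_2 algebra_simps)
qed

lemma tilde_conj:
  assumes "A ** B = mat 1" "B ** A = mat 1"
  shows "tilde A ** heis_mat (x, y, z) ** tilde B =
    heis_mat (A$1$1 * x - A$1$2 * y, A$2$2 * y - A$2$1 * x, det A * z)"
proof -
  let ?q = "(A$1$1 * x - A$1$2 * y, A$2$2 * y - A$2$1 * x, det A * z)"
  have "tilde A ** heis_mat (x, y, z) = heis_mat ?q ** tilde A"
    by (simp add: mat5_simps heis_mat_nth tilde_def)
      (simp add: det_2 power2_eq_square algebra_simps add_divide_distrib diff_divide_distrib)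
  then have "tilde A ** heis_mat (x, y, z) ** tilde B = heis_mat ?q ** (tilde A ** tilde B)"
    by (simp add: matrix_mul_assoc)
  then show ?thesis
    by (simp add: tilde_inverse[OF assms])
qed

lemma heis_mat_action:
  assumes "g \<in> carrier G_group"
  shows "heis_mat (heis_action g p) = g ** heis_mat p ** matrix_inv g"
proof -
  obtain A where A: "g = tilde A" "invertible A" using assms by (rule G_group_obtain)
  obtain B where B: "A ** B = mat 1" "B ** A = mat 1" using A(2) by (rule invertible_obtain)
  obtain x y z where p: "p = (x, y, z)" by (cases p)
  have "\<exists>q. heis_mat q = g ** heis_mat p ** matrix_inv g"
    unfolding p A(1) tilde_inverse(3)[OF B] tilde_conj[OF B] by blast
  then have "\<exists>!q. heis_mat q = g ** heis_mat p ** matrix_inv g"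
    using heis_mat_inj by (metis injD)
  then show ?thesis
    unfolding heis_action_def by (rule theI')
qed

lemma group_heis: "group (heis_group :: ('a::field_char_0 \<times> 'a \<times> 'a) monoid)"
proof (rule groupI)
  fix p q r :: "'a \<times> 'a \<times> 'a"
  have "heis_mat (p \<otimes>\<^bsub>heis_group\<^esub> q \<otimes>\<^bsub>heis_group\<^esub> r) = heis_mat (p \<otimes>\<^bsub>heis_group\<^esub> (q \<otimes>\<^bsub>heis_group\<^esub> r))"
    by (simp add: heis_mat_mult matrix_mul_assoc)
  then show "p \<otimes>\<^bsub>heis_group\<^esub> q \<otimes>\<^bsub>heis_group\<^esub> r = p \<otimes>\<^bsub>heis_group\<^esub> (q \<otimes>\<^bsub>heis_group\<^esub> r)"
    by (rule injD[OF heis_mat_inj])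
  obtain x y z where p: "p = (x, y, z)" by (cases p)
  show "\<exists>q\<in>carrier heis_group. q \<otimes>\<^bsub>heis_group\<^esub> p = \<one>\<^bsub>heis_group\<^esub>"
    by (rule bexI[of _ "(-x, -y, -z)"]) (simp_all add: heis_group_def p)
  show "\<one>\<^bsub>heis_group\<^esub> \<otimes>\<^bsub>heis_group\<^esub> p = p"
    by (simp add: heis_group_def p)
qed (simp_all add: heis_group_def)

lemma heis_action_mult:
  assumes g: "g \<in> carrier G_group" and g': "g' \<in> carrier G_group"
  shows "heis_action (g ** g') p = heis_action g (heis_action g' p)"
proof -
  obtain A where A: "g = tilde A" "invertible A" using g by (rule G_group_obtain)
  obtain B where B: "A ** B = mat 1" "B ** A = mat 1" using A(2) by (rule invertible_obtain)
  obtain C where C: "g' = tilde C" "invertible C" using g' by (rule G_group_obtain)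
  obtain D where D: "C ** D = mat 1" "D ** C = mat 1" using C(2) by (rule invertible_obtain)
  have "(A ** C) ** (D ** B) = A ** (C ** D) ** B" "(D ** B) ** (A ** C) = D ** (B ** A) ** C"
    by (simp_all add: matrix_mul_assoc)
  then have AC: "(A ** C) ** (D ** B) = mat 1" "(D ** B) ** (A ** C) = mat 1"
    by (simp_all add: B D)
  have "matrix_inv (g ** g') = matrix_inv g' ** matrix_inv g"
    using tilde_inverse(3)[OF AC] by (simp add: A C tilde_inverse(3)[OF B] tilde_inverse(3)[OF D] tilde_mult)
  moreover have "g ** g' \<in> carrier G_group"
    using tilde_in_G[OF invertible_mult[OF A(2) C(2)]] by (simp add: A C tilde_mult)
  ultimately have "heis_mat (heis_action (g ** g') p) = heis_mat (heis_action g (heis_action g' p))"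
    using g g' by (simp add: heis_mat_action matrix_mul_assoc)
  then show ?thesis by (rule injD[OF heis_mat_inj])
qed

lemma heis_action_one: "heis_action (mat 1) p = p"
proof -
  have "mat 1 \<in> carrier (G_group :: ('a ^ 5 ^ 5) monoid)"
    using tilde_in_G[OF invertible_mat_1] by (simp add: tilde_one)
  moreover have "matrix_inv (mat 1 :: 'a ^ 5 ^ 5) = mat 1"
    by (rule matrix_inv_eq) simp_all
  ultimately have "heis_mat (heis_action (mat 1) p) = heis_mat p"
    by (simp add: heis_mat_action)
  then show ?thesis by (rule injD[OF heis_mat_inj])
qed

lemma heis_action_hom:
  "heis_action \<in> hom (G_group :: ('a::field_char_0 ^ 5 ^ 5) monoid) (AutoGroup heis_group)"
proof -
  have c: "carrier (heis_group :: ('a \<times> 'a \<times> 'a) monoid) = UNIV" by (simp add: heis_group_def)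
  have auto: "heis_action g \<in> auto heis_group" if g: "g \<in> carrier G_group" for g :: "'a ^ 5 ^ 5"
  proof -
    obtain A where A: "g = tilde A" "invertible A" using g by (rule G_group_obtain)
    obtain B where B: "A ** B = mat 1" "B ** A = mat 1" "invertible B"
      using A(2) by (rule invertible_obtain)
    note g' = tilde_in_G[OF B(3)]
    have gg': "g ** tilde B = mat 1" "tilde B ** g = mat 1"
      by (simp_all add: A tilde_inverse[OF B(1,2)])
    have "heis_action (tilde B) (heis_action g p) = p" "heis_action g (heis_action (tilde B) p) = p" for p
      by (simp_all add: gg' heis_action_one flip: heis_action_mult[OF g g'] heis_action_mult[OF g' g])
    then have "bij (heis_action g)" by (intro o_bij[of "heis_action (tilde B)"]) (simp_all add: fun_eq_iff)
    then have "heis_action g \<in> Bij UNIV" by (simp add: Bij_def)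
    moreover have "heis_action g (p \<otimes>\<^bsub>heis_group\<^esub> q) = heis_action g p \<otimes>\<^bsub>heis_group\<^esub> heis_action g q" for p q
    proof -
      have "g ** (heis_mat p ** heis_mat q) ** tilde B =
          g ** heis_mat p ** ((tilde B ** g) ** heis_mat q ** tilde B)"
        by (simp add: gg' matrix_mul_assoc)
      then have "heis_mat (heis_action g (p \<otimes>\<^bsub>heis_group\<^esub> q)) =
          heis_mat (heis_action g p \<otimes>\<^bsub>heis_group\<^esub> heis_action g q)"
        by (simp add: heis_mat_action[OF g] heis_mat_mult matrix_inv_eq[OF gg'] matrix_mul_assoc)
      then show ?thesis by (rule injD[OF heis_mat_inj])
    qed
    ultimately show ?thesis by (simp add: auto_def hom_def c)
  qed
  show ?thesis
  proof (rule homI)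
    fix g h :: "'a ^ 5 ^ 5"
    assume g: "g \<in> carrier G_group" and h: "h \<in> carrier G_group"
    show "heis_action g \<in> carrier (AutoGroup heis_group)"
      using auto[OF g] by (simp add: AutoGroup_def)
    have "heis_action (g \<otimes>\<^bsub>G_group\<^esub> h) = compose UNIV (heis_action g) (heis_action h)"
      by (rule ext) (simp add: compose_def heis_action_mult[OF g h, symmetric] G_group_def)
    then show "heis_action (g \<otimes>\<^bsub>G_group\<^esub> h) = heis_action g \<otimes>\<^bsub>AutoGroup heis_group\<^esub> heis_action h"
      using auto[OF g] auto[OF h] by (simp add: AutoGroup_def BijGroup_def auto_def c)
  qed
qed

end

theory Submission
  imports Defs
begin

text \<open>An automorphism \<open>f\<close> is determined by \<open>f e\<^sub>1\<close> and \<open>f e\<^sub>2\<close>; let \<open>A\<close> be its action modulo the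
  derived algebra, that is, its upper left \<open>2 \<times> 2\<close> block. The image of \<open>e\<^sub>3\<close> is \<open>det A \<cdot> e\<^sub>3\<close> plus
  an element of the centre, which is orthogonal to the derived algebra, so \<open>\<langle>f e\<^sub>3, f e\<^sub>3\<rangle> = 1\<close> forces \<open>(det A)\<^sup>2 = 1\<close>. Then \<open>f\<close>
  composed with the inverse of the orthogonal automorphism \<open>tilde A\<close> is the identity on that block,
  and the relations \<open>\<langle>e\<^sub>i, e\<^sub>j\<rangle> = 0\<close> for \<open>i, j \<le> 2\<close> are exactly what places it in the image of
  \<open>heis_mat\<close>.\<close>

text \<open>Lets an isomorphism be built in the convenient direction, out of the semidirect product,
  and then reversed. Closure of \<open>G\<close> puts the product of two values of the inverse in
  the carrier, where the inverse undoes \<open>h\<close>.\<close>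

lemma iso_inv_into_closed:
  assumes h: "h \<in> iso G H"
    and closed: "\<And>x y. x \<in> carrier G \<Longrightarrow> y \<in> carrier G \<Longrightarrow> x \<otimes>\<^bsub>G\<^esub> y \<in> carrier G"
  shows "inv_into (carrier G) h \<in> iso H G"
proof -
  have hom: "h \<in> hom G H" and bij: "bij_betw h (carrier G) (carrier H)"
    using h by (auto simp: iso_def)
  let ?k = "inv_into (carrier G) h"
  have bij': "bij_betw ?k (carrier H) (carrier G)" by (rule bij_betw_inv_into[OF bij])
  have "?k \<in> hom H G"
  proof (rule homI)
    fix x y assume x: "x \<in> carrier H" and y: "y \<in> carrier H"
    show kx: "?k x \<in> carrier G" using bij' x by (rule bij_betwE[rule_format])
    have ky: "?k y \<in> carrier G" using bij' y by (rule bij_betwE[rule_format])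
    have "h (?k x \<otimes>\<^bsub>G\<^esub> ?k y) = x \<otimes>\<^bsub>H\<^esub> y"
      by (simp add: hom_mult[OF hom kx ky] bij_betw_inv_into_right[OF bij] x y)
    then show "?k (x \<otimes>\<^bsub>H\<^esub> y) = ?k x \<otimes>\<^bsub>G\<^esub> ?k y"
      using bij_betw_inv_into_left[OF bij closed[OF kx ky]] by simp
  qed
  then show ?thesis using bij' by (simp add: iso_def)
qed

lemma orth_autsD:
  assumes "f \<in> orth_auts"
  shows "f (bracket x y) = bracket (f x) (f y)" "bform (f x) (f y) = bform x y"
  using assms by (auto simp: orth_auts_def lie_auts_def)

lemma orth_auts_matrix:
  assumes "f \<in> orth_auts"
  obtains M where "f = (*v) M"
proof
  have "Vector_Spaces.linear (*s) (*s) f" using assms by (simp add: orth_auts_def lie_auts_def)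
  then show "f = (*v) (matrix f)" by (simp add: fun_eq_iff matrix_works)
qed

lemma orth_auts_comp:
  assumes f: "f \<in> orth_auts" and g: "g \<in> orth_auts"
  shows "f \<circ> g \<in> orth_auts"
proof -
  have "Vector_Spaces.linear (*s) (*s) f" "Vector_Spaces.linear (*s) (*s) g" "bij f" "bij g"
    using f g by (simp_all add: orth_auts_def lie_auts_def)
  then show ?thesis
    by (simp add: orth_auts_def lie_auts_def Vector_Spaces.linear_compose bij_comp
        orth_autsD[OF f] orth_autsD[OF g])
qed

lemma heis_mat_orth: "(*v) (heis_mat p) \<in> orth_auts"
proof -
  obtain x y z where p: "p = (x, y, z)" by (cases p)
  have "bform (heis_mat p *v u) (heis_mat p *v v) = bform u v" for u v
    by (simp add: bform_def matvec5 p heis_mat_nth)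
      (simp add: field_simps power2_eq_square)
  then show ?thesis using heis_mat_aut by (simp add: orth_auts_def)
qed

text \<open>The form pairs the planes of \<open>e\<^sub>1, e\<^sub>2\<close> and
  \<open>e\<^sub>4, e\<^sub>5\<close> by a determinant. Acting by \<open>A\<close> on both gives one
  factor \<open>det A\<close>, the extra scalar on the lower block a second, and
  \<open>e\<^sub>3\<close> also contributes \<open>(det A)\<^sup>2\<close>.\<close>

lemma tilde_orth:
  assumes "invertible A" and "det A = 1 \<or> det A = -1"
  shows "(*v) (tilde A) \<in> orth_auts"
proof -
  have "bform (tilde A *v u) (tilde A *v v) = (det A)\<^sup>2 * bform u v" for u v
    by (simp add: bform_def matvec5 tilde_def)
      (simp add: det_2 power2_eq_square algebra_simps)
  moreover have "(det A)\<^sup>2 = 1" using assms(2) by auto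
  ultimately show ?thesis using tilde_aut[OF assms(1)] by (simp add: orth_auts_def)
qed

lemma matvec_axis_nth: "(M *v axis j 1) $ i = M $ i $ j"
  for M :: "'a::semiring_1 ^ 5 ^ 5"
  using exhaust_5[of j] by (auto simp: matvec5 axis_def)

text \<open>Since \<open>e\<^sub>3\<close>, \<open>e\<^sub>4\<close>, \<open>e\<^sub>5\<close> are
  brackets of earlier basis vectors, the first two columns determine column 3, and these three
  determine columns 4 and 5.\<close>

lemma aut_columns:
  assumes "(*v) M \<in> lie_auts"
  shows "M $ i $ 3 = bracket (M *v axis 1 1) (M *v axis 2 1) $ i"
    and "M $ i $ 4 = bracket (M *v axis 1 1) (M *v axis 3 1) $ i"
    and "M $ i $ 5 = bracket (M *v axis 2 1) (M *v axis 3 1) $ i"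
proof -
  have br: "M *v bracket u v = bracket (M *v u) (M *v v)" for u v
    using assms by (simp add: lie_auts_def)
  show "M $ i $ 3 = bracket (M *v axis 1 1) (M *v axis 2 1) $ i"
    "M $ i $ 4 = bracket (M *v axis 1 1) (M *v axis 3 1) $ i"
    "M $ i $ 5 = bracket (M *v axis 2 1) (M *v axis 3 1) $ i"
    by (simp_all add: bracket_basis matvec_axis_nth flip: br)
qed

definition upper_block :: "'a ^ 5 ^ 5 \<Rightarrow> 'a::zero ^ 2 ^ 2" where
  "upper_block M = vector [vector [M $ 1 $ 1, M $ 1 $ 2], vector [M $ 2 $ 1, M $ 2 $ 2]]"

text \<open>The first two rows of \<open>heis_mat p\<close> are those of the identity. This recovers
  \<open>A\<close> from the product.\<close>

lemma upper_block_heis_tilde: "upper_block (heis_mat p ** tilde A) = A"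
proof -
  obtain x y z where p: "p = (x, y, z)" by (cases p)
  show ?thesis
    by (simp add: p vec_eq_iff forall_2 upper_block_def mult5 heis_mat_nth tilde_def)
qed

text \<open>The first two columns of \<open>tilde B\<close> vanish below row 2, so they meet only
  the first two columns of \<open>M\<close>.\<close>

lemma upper_block_mult_tilde:
  assumes "(*v) M \<in> lie_auts"
  shows "upper_block (M ** tilde B) = upper_block M ** B"
  by (simp add: vec_eq_iff forall_2 upper_block_def mult5 mult2 tilde_def
      aut_columns[OF assms] bracket_def)

lemma det_upper_block:
  assumes "(*v) M \<in> orth_auts"
  shows "det (upper_block M) = 1 \<or> det (upper_block M) = -1"
proof -
  have aut: "(*v) M \<in> lie_auts" using assms by (simp add: orth_auts_def)
  have "bform (M *v axis 3 1) (M *v axis 3 1) = 1"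
    by (simp add: orth_autsD(2)[OF assms] bform_basis)
  then have "(det (upper_block M))\<^sup>2 = 1"
    by (simp add: bform_def matvec_axis_nth aut_columns(1)[OF aut] bracket_def)
      (simp add: matvec_axis_nth upper_block_def det_2 power2_eq_square algebra_simps)
  then show ?thesis by (simp add: power2_eq_1_iff)
qed

text \<open>The parameters are read off \<open>heis_mat (x, y, z)\<close>: row 3 begins with
  \<open>y, x\<close>, and entry (4,1) is \<open>z + x * y / 2\<close>.\<close>

lemma orth_unipotent_heis:
  fixes M :: "'a::field_char_0 ^ 5 ^ 5"
  assumes orth: "(*v) M \<in> orth_auts" and one: "upper_block M = mat 1"
  shows "M = heis_mat (M $ 3 $ 2, M $ 3 $ 1, M $ 4 $ 1 - M $ 3 $ 2 * M $ 3 $ 1 / 2)"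
proof -
  have aut: "(*v) M \<in> lie_auts" using orth by (simp add: orth_auts_def)
  have top: "M $ 1 $ 1 = 1" "M $ 1 $ 2 = 0" "M $ 2 $ 1 = 0" "M $ 2 $ 2 = 1"
    using one by (simp_all add: upper_block_def vec_eq_iff forall_2 mat_nth)
  note col3 = aut_columns(1)[OF aut, unfolded bracket_def]
  have c3: "M $ 1 $ 3 = 0" "M $ 2 $ 3 = 0" "M $ 3 $ 3 = 1" "M $ 4 $ 3 = M $ 3 $ 2"
    "M $ 5 $ 3 = - M $ 3 $ 1"
    by (simp_all add: col3 matvec_axis_nth top)
  \<comment> \<open>By \<open>c3\<close> the image of \<open>e\<^sub>3\<close> is
    \<open>e\<^sub>3\<close> plus a central element, which brackets kill; hence
    \<open>e\<^sub>4\<close> and \<open>e\<^sub>5\<close> are fixed.\<close>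
  have c4: "M $ 1 $ 4 = 0" "M $ 2 $ 4 = 0" "M $ 3 $ 4 = 0" "M $ 4 $ 4 = 1" "M $ 5 $ 4 = 0"
    by (simp_all add: aut_columns(2)[OF aut] bracket_def matvec_axis_nth top c3)
  have c5: "M $ 1 $ 5 = 0" "M $ 2 $ 5 = 0" "M $ 3 $ 5 = 0" "M $ 4 $ 5 = 0" "M $ 5 $ 5 = 1"
    by (simp_all add: aut_columns(3)[OF aut] bracket_def matvec_axis_nth top c3)
  \<comment> \<open>Only entries (5,1), (4,2) and (5,2) remain to be expressed by the parameters.
    The three products among \<open>e\<^sub>1, e\<^sub>2\<close> give one equation for each; the
    first two are solved by halving.\<close>
  have form: "bform (M *v axis i 1) (M *v axis j 1) = bform (axis i 1) (axis j 1)" for i j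
    by (rule orth_autsD(2)[OF orth])
  have iso: "bform (axis 1 1) (axis 1 1) = (0 :: 'a)" "bform (axis 2 1) (axis 2 1) = (0 :: 'a)"
    "bform (axis 1 1) (axis 2 1) = (0 :: 'a)"
    by (simp_all add: bform_def axis_def)
  have "2 * M $ 5 $ 1 + (M $ 3 $ 1)\<^sup>2 = 0"
    using form[of 1 1, unfolded iso] by (simp add: bform_def matvec_axis_nth top power2_eq_square)
  then have q: "M $ 5 $ 1 = - ((M $ 3 $ 1)\<^sup>2 / 2)"
    by (simp add: field_simps eq_neg_iff_add_eq_0)
  have "(M $ 3 $ 2)\<^sup>2 - 2 * M $ 4 $ 2 = 0"
    using form[of 2 2, unfolded iso] by (simp add: bform_def matvec_axis_nth top power2_eq_square)
  then have r: "M $ 4 $ 2 = (M $ 3 $ 2)\<^sup>2 / 2"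
    by (simp add: field_simps)
  have "M $ 5 $ 2 - M $ 4 $ 1 + M $ 3 $ 1 * M $ 3 $ 2 = 0"
    using form[of 1 2, unfolded iso] by (simp add: bform_def matvec_axis_nth top)
  then have s: "M $ 5 $ 2 = M $ 4 $ 1 - M $ 3 $ 1 * M $ 3 $ 2"
    by (simp add: algebra_simps)
  show ?thesis
    by (simp add: mat5_eq_iff forall_5 heis_mat_nth top c3 c4 c5 q r s)
qed

lemma orth_auts_decomp:
  assumes orth: "(*v) M \<in> orth_auts"
  obtains p A where "M = heis_mat p ** tilde A" "invertible A" "det A = 1 \<or> det A = -1"
proof -
  have aut: "(*v) M \<in> lie_auts" using orth by (simp add: orth_auts_def)
  define A where "A = upper_block M"
  have d: "det A = 1 \<or> det A = -1" unfolding A_def by (rule det_upper_block[OF orth])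
  have A: "invertible A" using d by (auto simp: invertible_det_nz)
  obtain B where B: "A ** B = mat 1" "B ** A = mat 1" "invertible B"
    using A by (rule invertible_obtain)
  \<comment> \<open>The inverse block also has determinant 1 or -1, so \<open>tilde B\<close> is
    orthogonal and multiplying by it stays among the orthogonal automorphisms.\<close>
  have "det A * det B = 1" using arg_cong[OF B(1), of det] by (simp add: det_mul)
  then have "det B = 1 \<or> det B = -1" using d by (auto simp: minus_equation_iff)
  then have "(*v) (M ** tilde B) \<in> orth_auts"
    using orth_auts_comp[OF orth tilde_orth[OF B(3)]] by (simp add: comp_def matrix_vector_mul_assoc)
  moreover have "upper_block (M ** tilde B) = mat 1"
    using B(1) by (simp add: upper_block_mult_tilde[OF aut] A_def)
  ultimately obtain p where "M ** tilde B = heis_mat p"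
    using orth_unipotent_heis by blast
  then have "heis_mat p ** tilde A = M ** (tilde B ** tilde A)"
    by (simp add: matrix_mul_assoc)
  then have "M = heis_mat p ** tilde A" by (simp add: tilde_inverse[OF B(1,2)])
  then show thesis using A d by (rule that)
qed

text \<open>Uniqueness of the factorisation: the upper left block yields \<open>A\<close>, and
  cancelling the invertible \<open>tilde A\<close> leaves injectivity of
  \<open>heis_mat\<close>.\<close>

lemma heis_tilde_inj:
  assumes eq: "heis_mat p ** tilde A = heis_mat q ** tilde C" and A: "invertible A"
  shows "p = q" "A = C"
proof -
  show AC: "A = C" using arg_cong[OF eq, of upper_block] by (simp add: upper_block_heis_tilde)
  obtain B where B: "A ** B = mat 1" "B ** A = mat 1" using A by (rule invertible_obtain)
  have "heis_mat p ** (tilde A ** tilde B) = heis_mat q ** (tilde A ** tilde B)"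
    using eq by (simp add: matrix_mul_assoc AC)
  then have "heis_mat p = heis_mat q" by (simp add: tilde_inverse[OF B])
  then show "p = q" by (rule injD[OF heis_mat_inj])
qed

text \<open>The conjugation formula without inverses, in the form that moves \<open>g\<close> past a
  Heisenberg factor.\<close>

lemma heis_action_commute:
  assumes "g \<in> carrier G_group"
  shows "heis_mat (heis_action g p) ** g = g ** heis_mat p"
proof -
  obtain A where A: "g = tilde A" "invertible A" using assms by (rule G_group_obtain)
  obtain B where B: "A ** B = mat 1" "B ** A = mat 1" using A(2) by (rule invertible_obtain)
  have "heis_mat (heis_action g p) ** g = g ** heis_mat p ** (matrix_inv g ** g)"
    by (simp add: heis_mat_action[OF assms] matrix_mul_assoc)
  then show ?thesis by (simp add: A(1) tilde_inverse[OF B])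
qed

theorem proposition4p2:
  shows "(Auto_group :: ('a::field_char_0 ^ 5 \<Rightarrow> 'a ^ 5) monoid)
    \<cong> semidirect (S_group :: ('a ^ 5 ^ 5) monoid)
        (heis_group :: ('a \<times> 'a \<times> 'a) monoid) heis_action"
proof -
  let ?Sd = "semidirect (S_group :: ('a ^ 5 ^ 5) monoid) heis_group heis_action"
  let ?A = "Auto_group :: ('a ^ 5 \<Rightarrow> 'a ^ 5) monoid"
  \<comment> \<open>The Heisenberg factor stands on the left because in \<open>semidirect\<close>
    the pair \<open>(s, h)\<close> represents the product \<open>h s\<close>.\<close>
  define \<psi> :: "('a ^ 5 ^ 5) \<times> ('a \<times> 'a \<times> 'a) \<Rightarrow> 'a ^ 5 \<Rightarrow> 'a ^ 5"
    where "\<psi> = (\<lambda>(s, p). (*v) (heis_mat p ** s))"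
  have car: "carrier ?Sd = carrier S_group \<times> UNIV"
    by (simp add: semidirect_def heis_group_def)
  have SG: "s \<in> carrier G_group" if "s \<in> carrier S_group" for s :: "'a ^ 5 ^ 5"
    using subgroup.subset[OF subgroup_S] that by blast
  have S_mult: "s \<otimes>\<^bsub>S_group\<^esub> t = s ** t" for s t :: "'a ^ 5 ^ 5"
    by (simp add: S_group_def G_group_def)
  have S_closed: "s ** t \<in> carrier S_group"
    if "s \<in> carrier S_group" "t \<in> carrier S_group" for s t :: "'a ^ 5 ^ 5"
    using subgroup.m_closed[OF subgroup_S that] by (simp add: G_group_def)
  have \<psi>_in: "\<psi> x \<in> carrier ?A" if x: "x \<in> carrier ?Sd" for x
  proof -
    obtain s p where sp: "x = (s, p)" "s \<in> carrier S_group" using x car by auto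
    obtain A where "s = tilde A" "invertible A" "det A = 1 \<or> det A = -1"
      using sp(2) by (rule S_group_obtain)
    then show ?thesis
      using orth_auts_comp[OF heis_mat_orth[of p] tilde_orth[of A]]
      by (simp add: \<psi>_def sp Auto_group_def comp_def matrix_vector_mul_assoc)
  qed
  have "\<psi> \<in> hom ?Sd ?A"
  proof (rule homI)
    fix x y assume x: "x \<in> carrier ?Sd" and y: "y \<in> carrier ?Sd"
    obtain s p where sp: "x = (s, p)" "s \<in> carrier S_group" using x car by auto
    obtain t q where tq: "y = (t, q)" using y car by auto
    \<comment> \<open>The twist in the semidirect product is what lets \<open>s\<close> cross
      \<open>heis_mat q\<close>, turning the product of the pairs into the product of their
      images.\<close>
    have "heis_mat p ** heis_mat (heis_action s q) ** (s ** t) =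
        heis_mat p ** (heis_mat (heis_action s q) ** s) ** t"
      by (simp add: matrix_mul_assoc)
    also have "\<dots> = (heis_mat p ** s) ** (heis_mat q ** t)"
      by (simp add: heis_action_commute[OF SG[OF sp(2)]] matrix_mul_assoc)
    finally show "\<psi> (x \<otimes>\<^bsub>?Sd\<^esub> y) = \<psi> x \<otimes>\<^bsub>?A\<^esub> \<psi> y"
      by (simp add: \<psi>_def sp tq semidirect_def Auto_group_def S_mult heis_mat_mult
          fun_eq_iff matrix_vector_mul_assoc)
  qed (rule \<psi>_in)
  moreover have "bij_betw \<psi> (carrier ?Sd) (carrier ?A)"
  proof (rule bij_betw_imageI)
    show "inj_on \<psi> (carrier ?Sd)"
    proof (rule inj_onI)
      fix x y assume x: "x \<in> carrier ?Sd" and y: "y \<in> carrier ?Sd" and eq: "\<psi> x = \<psi> y"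
      obtain s p where sp: "x = (s, p)" "s \<in> carrier S_group" using x car by auto
      obtain t q where tq: "y = (t, q)" "t \<in> carrier S_group" using y car by auto
      obtain A where A: "s = tilde A" "invertible A" using sp(2) by (rule S_group_obtain)
      obtain C where C: "t = tilde C" using tq(2) by (rule S_group_obtain)
      have "heis_mat p ** tilde A = heis_mat q ** tilde C"
        using eq by (simp add: \<psi>_def sp tq A C matrix_eq fun_eq_iff)
      from heis_tilde_inj[OF this A(2)] show "x = y" by (simp add: sp tq A C)
    qed
    show "\<psi> ` carrier ?Sd = carrier ?A"
    proof
      show "\<psi> ` carrier ?Sd \<subseteq> carrier ?A" using \<psi>_in by blast
      show "carrier ?A \<subseteq> \<psi> ` carrier ?Sd"
      proof
        fix f assume "f \<in> carrier ?A"
        then have f: "f \<in> orth_auts" by (simp add: Auto_group_def)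
        obtain M where M: "f = (*v) M" using f by (rule orth_auts_matrix)
        obtain p A where "M = heis_mat p ** tilde A" "invertible A" "det A = 1 \<or> det A = -1"
          using f[unfolded M] by (rule orth_auts_decomp)
        then have "f = \<psi> (tilde A, p)" "(tilde A, p) \<in> carrier ?Sd"
          by (simp_all add: M \<psi>_def car tilde_in_S)
        then show "f \<in> \<psi> ` carrier ?Sd" by blast
      qed
    qed
  qed
  ultimately have "\<psi> \<in> iso ?Sd ?A" by (simp add: iso_def)
  \<comment> \<open>Closure of the semidirect product is what reversing \<open>\<psi>\<close>
    requires.\<close>
  moreover have "x \<otimes>\<^bsub>?Sd\<^esub> y \<in> carrier ?Sd" if "x \<in> carrier ?Sd" "y \<in> carrier ?Sd" for x y
    using that by (auto simp: semidirect_def heis_group_def S_mult intro: S_closed)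
  ultimately show ?thesis
    using iso_inv_into_closed unfolding is_iso_def by blast
qed

end
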